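(* Let $\mathcal P$ and $\mathcal Q$ be nonempty classes of probability distributions on a measurable space $(\mathcal X,\mathcal A)$. Let $\{T_\gamma\}_{\gamma>0}$ be a family of stopping times (with respect to the natural filtration of the observations) satisfying the average run length constraint $\inf_{P\in\mathcal P}\mathbb E_{P^\infty}[T_\gamma]\ge\gamma$ for every $\gamma>0$. Then for every $Q\in\mathcal Q$ with $0<I(Q;\mathcal P)<\infty$, $$\liminf_{\gamma\to\infty}\ \frac{\mathcal C_Q(T_\gamma)}{\log\gamma}\ \ge\ \frac{1}{I(Q;\mathcal P)}.$$
   Context: Observations $X_1,X_2,\dots$ are the coordinate maps on $\mathcal X^{\mathbb N}$, with filtration $\mathcal F_n=\sigma(X_1,\dots,X_n)$ ($n\ge1$), $\mathcal F_0$ trivial. Stopping times are with respect to $(\mathcal F_n)$ and take values in $\{1,2,\dots\}\cup\{\infty\}$. For $P\in\mathcal P$, $P^\infty$ is the i.i.d. product measure (no-change law). For $k\ge1$, $P\in\mathcal P$, $Q\in\mathcal Q$, $\mathbb P^{(P)}_{k,Q}$ (expectation $\mathbb E^{(P)}_{k,Q}$) is the law under which all $X_i$ are independent, $X_1,\dots,X_{k-1}$ are distributed as $P$, and $X_k,X_{k+1},\dots$ are distributed as $Q$. Pollak's conditional average delay to detection of a stopping time $T$ is $$\mathcal C_Q(T):=\sup_{P\in\mathcal P}\ \sup_{k\ge1}\ \mathbb E^{(P)}_{k,Q}\big[(T-k+1)^+\,\big|\,T\ge k\big]\in[0,\infty],$$ where the supremum runs over those $(P,k)$ with $\mathbb P^{(P)}_{k,Q}(T\ge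 k)>0$. $\mathrm{KL}(Q\|P)$ is the Kullback–Leibler divergence ($+\infty$ if $Q\not\ll P$), and $I(Q;\mathcal P):=\inf_{P\in\mathcal P}\mathrm{KL}(Q\|P)$. *)

theory Defs
  imports "HOL-Probability.Probability"
begin

text \<open>
  Kullback--Leibler divergence \<open>KL(Q\<parallel>P)\<close> in nats. The library's \<open>KL_divergence b P Q\<close> has the
  reference measure first and is a Bochner integral, hence \<open>0\<close> when the log density is not
  integrable. For probability measures with \<open>Q\<close> absolutely continuous with respect to \<open>P\<close>, the
  negative part of \<open>ln (dQ/dP)\<close> is always \<open>Q\<close>-integrable, so non-integrability means that the
  divergence is \<open>+\<infinity>\<close>.
\<close>

definition KL_div :: "'a measure \<Rightarrow> 'a measure \<Rightarrow> ereal" where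
  "KL_div Q P =
    (if absolutely_continuous P Q \<and> integrable Q (entropy_density (exp 1) P Q)
     then ereal (KL_divergence (exp 1) P Q) else \<infinity>)"

definition KL_inf :: "'a measure \<Rightarrow> 'a measure set \<Rightarrow> ereal" where
  "KL_inf Q \<P> = (INF P\<in>\<P>. KL_div Q P)"

text \<open>
  Observation sequences are indexed by the positive integers: the \<open>i\<close>-th observation is
  \<open>\<lambda>\<omega>. \<omega> i\<close> for \<open>i \<ge> 1\<close>.
\<close>

definition obs_space :: "'a measure \<Rightarrow> (nat \<Rightarrow> 'a) measure" where
  "obs_space A = (\<Pi>\<^sub>M i\<in>{1..}. A)"

text \<open>
  The \<open>\<sigma>\<close>-algebra generated by the first \<open>n\<close> observations. The index \<open>n\<close> is extended so that the
  library's \<open>stopping_time\<close> covers times with value \<open>\<infinity>\<close>; its condition at index \<open>\<infinity>\<close> is vacuous.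
\<close>

definition obs_filtration :: "'a measure \<Rightarrow> enat \<Rightarrow> (nat \<Rightarrow> 'a) measure" where
  "obs_filtration A n =
    sigma (space (obs_space A))
      {{\<omega> \<in> space (obs_space A). \<omega> i \<in> B} | i B. 1 \<le> i \<and> enat i \<le> n \<and> B \<in> sets A}"

definition obs_stopping_time :: "'a measure \<Rightarrow> ((nat \<Rightarrow> 'a) \<Rightarrow> enat) \<Rightarrow> bool" where
  "obs_stopping_time A T \<longleftrightarrow>
    stopping_time (obs_filtration A) T \<and> (\<forall>\<omega>\<in>space (obs_space A). 1 \<le> T \<omega>)"

definition no_change_law :: "'a measure \<Rightarrow> (nat \<Rightarrow> 'a) measure" where
  "no_change_law P = (\<Pi>\<^sub>M i\<in>{1..}. P)"

definition change_law :: "'a measure \<Rightarrow> nat \<Rightarrow> 'a measure \<Rightarrow> (nat \<Rightarrow> 'a) measure" where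
  "change_law P k Q = (\<Pi>\<^sub>M i\<in>{1..}. if i < k then P else Q)"

definition not_yet_stopped ::
  "'a measure \<Rightarrow> nat \<Rightarrow> 'a measure \<Rightarrow> ((nat \<Rightarrow> 'a) \<Rightarrow> enat) \<Rightarrow> (nat \<Rightarrow> 'a) set" where
  "not_yet_stopped P k Q T = {\<omega> \<in> space (change_law P k Q). enat k \<le> T \<omega>}"

text \<open>
  Conditional expectation of \<open>(T - k + 1)\<^sup>+\<close> given \<open>T \<ge> k\<close>; the truncated subtraction on \<open>enat\<close>
  is the positive part, and \<open>\<infinity> - enat k = \<infinity>\<close>.
\<close>

definition cond_delay ::
  "'a measure \<Rightarrow> nat \<Rightarrow> 'a measure \<Rightarrow> ((nat \<Rightarrow> 'a) \<Rightarrow> enat) \<Rightarrow> ennreal" where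
  "cond_delay P k Q T =
    (\<integral>\<^sup>+\<omega>. ennreal_of_enat (T \<omega> + 1 - enat k)
       \<partial>uniform_measure (change_law P k Q) (not_yet_stopped P k Q T))"

definition CADD :: "'a measure set \<Rightarrow> 'a measure \<Rightarrow> ((nat \<Rightarrow> 'a) \<Rightarrow> enat) \<Rightarrow> ennreal" where
  "CADD \<P> Q T =
    (SUP (P, k) \<in> {(P, k). P \<in> \<P> \<and> 1 \<le> k \<and>
                          0 < emeasure (change_law P k Q) (not_yet_stopped P k Q T)}.
       cond_delay P k Q T)"

end

theory Submission
  imports Defs "HOL-Real_Asymp.Real_Asymp"
begin

text \<open>
  Fix \<open>P\<close> with \<open>I = KL(Q\<parallel>P) < \<infinity>\<close>, write \<open>l = ln (dQ/dP)\<close>, and let \<open>M\<close> be about \<open>(ln \<gamma>)\<^sup>2\<close>.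
  Since \<open>\<Sum>\<^sub>t P\<^sup>\<infinity>(T > t) \<ge> \<gamma>\<close> while \<open>\<Sum>\<^sub>t P\<^sup>\<infinity>(t < T \<le> t + M) \<le> M\<close>, there is a \<open>t\<close> such that a false
  alarm in the window \<open>(t, t + M]\<close> has conditional probability less than \<open>c = 2M/\<gamma>\<close> given \<open>T > t\<close>.
  Let the change happen at \<open>t + 1\<close>, and let \<open>Z\<close> be the log-likelihood ratio of the observations
  from the change point to \<open>min T (t + M)\<close>. A change of measure at this stopping time gives
  \<open>E[exp (ln (1/c) 1{T \<le> t + M} - Z) | T > t] \<le> 2\<close>, hence by Jensen's inequality
  \<open>ln (1/c) P(T \<le> t + M | T > t) - E[Z | T > t] \<le> ln 2\<close>. By Wald's identity \<open>E[Z | T > t]\<close> is at most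
  \<open>I\<close> times the conditional delay \<open>D\<close>, and \<open>P(T > t + M | T > t) \<le> D/M\<close> by Markov's inequality.
  So \<open>D \<ge> (ln (1/c) - ln 2) / (I + ln (1/c) / M)\<close>, which is asymptotic to \<open>ln \<gamma> / I\<close>. No law of
  large numbers is needed.
\<close>

subsection \<open>Product measures and the observation filtration\<close>

text \<open>The product law is the image of \<open>M i\<close> times the remaining product under the
  update \<open>X(i := x)\<close>, so Tonelli makes coordinate \<open>i\<close> the inner integral.
  Infinite \<open>I\<close> is covered, which later lets the law of a single observation be
  exchanged.\<close>

lemma nn_integral_PiM_split_coordinate:
  assumes M: "\<And>i. i \<in> I \<Longrightarrow> prob_space (M i)" and i: "i \<in> I"
    and f: "f \<in> borel_measurable (PiM I M)"
  shows "(\<integral>\<^sup>+\<omega>. f \<omega> \<partial>PiM I M) = (\<integral>\<^sup>+X. (\<integral>\<^sup>+x. f (X(i := x)) \<partial>M i) \<partial>PiM (I - {i}) M)"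
proof -
  interpret i: prob_space "M i" using M i by auto
  interpret R: prob_space "PiM (I - {i}) M" by (intro prob_space_PiM M) auto
  interpret pair_sigma_finite "M i" "PiM (I - {i}) M" ..
  have I: "insert i (I - {i}) = I" using i by auto
  have m: "(\<lambda>(x, X). X(i := x)) \<in> M i \<Otimes>\<^sub>M PiM (I - {i}) M \<rightarrow>\<^sub>M PiM I M"
    using measurable_fun_upd[of I "I - {i}" i snd "M i \<Otimes>\<^sub>M PiM (I - {i}) M" M fst] I
    by (simp add: case_prod_beta')
  have "(\<integral>\<^sup>+\<omega>. f \<omega> \<partial>PiM I M)
      = (\<integral>\<^sup>+\<omega>. f \<omega> \<partial>distr (M i \<Otimes>\<^sub>M PiM (I - {i}) M) (PiM I M) (\<lambda>(x, X). X(i := x)))"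
    using distr_pair_PiM_eq_PiM[of "I - {i}" M i] M i I by simp
  also have "\<dots> = (\<integral>\<^sup>+p. f (case p of (x, X) \<Rightarrow> X(i := x)) \<partial>(M i \<Otimes>\<^sub>M PiM (I - {i}) M))"
    by (rule nn_integral_distr[OF m]) (use f in simp)
  also have "\<dots> = (\<integral>\<^sup>+X. (\<integral>\<^sup>+x. f (X(i := x)) \<partial>M i) \<partial>PiM (I - {i}) M)"
    using nn_integral_snd[OF measurable_compose[OF m f]] by simp
  finally show ?thesis .
qed

text \<open>Coordinate \<open>i\<close> can be frozen at a fixed point \<open>x0\<close> inside the
  indicator of \<open>S\<close>; the integral of \<open>h\<close> then leaves the outer integral as
  a constant factor.\<close>

lemma nn_integral_indep_coordinate:
  fixes h :: "'a \<Rightarrow> ennreal"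
  assumes M: "\<And>i. i \<in> I \<Longrightarrow> prob_space (M i)" and i: "i \<in> I"
    and h: "h \<in> borel_measurable (M i)" and S: "S \<in> sets (PiM I M)"
    and inv: "\<And>\<omega> \<omega>'. \<omega> \<in> space (PiM I M) \<Longrightarrow> \<omega>' \<in> space (PiM I M) \<Longrightarrow>
                (\<And>j. j \<noteq> i \<Longrightarrow> \<omega> j = \<omega>' j) \<Longrightarrow> \<omega> \<in> S \<longleftrightarrow> \<omega>' \<in> S"
  shows "(\<integral>\<^sup>+\<omega>. indicator S \<omega> * h (\<omega> i) \<partial>PiM I M) = emeasure (PiM I M) S * (\<integral>\<^sup>+x. h x \<partial>M i)"
proof -
  interpret i: prob_space "M i" using M i by auto
  obtain x0 where x0: "x0 \<in> space (M i)" using i.not_empty by auto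
  have I: "insert i (I - {i}) = I" using i by auto
  have upd: "X(i := x) \<in> space (PiM I M)"
    if "X \<in> space (PiM (I - {i}) M)" "x \<in> space (M i)" for X x
    using that i by (auto simp: space_PiM PiE_def Pi_iff extensional_def)
  have *: "(\<integral>\<^sup>+\<omega>. indicator S \<omega> * g (\<omega> i) \<partial>PiM I M)
      = (\<integral>\<^sup>+X. indicator S (X(i := x0)) * (\<integral>\<^sup>+x. g x \<partial>M i) \<partial>PiM (I - {i}) M)"
    if g[measurable]: "g \<in> borel_measurable (M i)" for g :: "'a \<Rightarrow> ennreal"
  proof -
    have [measurable]: "S \<in> sets (PiM I M)" by fact
    have [measurable]: "(\<lambda>\<omega>. g (\<omega> i)) \<in> borel_measurable (PiM I M)"
      using measurable_compose[OF measurable_component_singleton[OF i, of M] g] .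
    have "(\<integral>\<^sup>+\<omega>. indicator S \<omega> * g (\<omega> i) \<partial>PiM I M)
        = (\<integral>\<^sup>+X. (\<integral>\<^sup>+x. indicator S (X(i := x)) * g x \<partial>M i) \<partial>PiM (I - {i}) M)"
      by (subst nn_integral_PiM_split_coordinate[OF M i]) auto
    also have "\<dots> = (\<integral>\<^sup>+X. (\<integral>\<^sup>+x. indicator S (X(i := x0)) * g x \<partial>M i) \<partial>PiM (I - {i}) M)"
    proof (intro nn_integral_cong)
      fix X x assume "X \<in> space (PiM (I - {i}) M)" "x \<in> space (M i)"
      then have "X(i := x) \<in> S \<longleftrightarrow> X(i := x0) \<in> S"
        by (intro inv upd x0) auto
      then show "indicator S (X(i := x)) * g x = indicator S (X(i := x0)) * g x"
        by (simp add: indicator_def)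
    qed
    finally show ?thesis by (simp add: nn_integral_cmult)
  qed
  have m: "(\<lambda>X. X(i := x0)) \<in> PiM (I - {i}) M \<rightarrow>\<^sub>M PiM I M"
    using measurable_fun_upd[of I "I - {i}" i "\<lambda>X. X" "PiM (I - {i}) M" M "\<lambda>_. x0"] I x0 by simp
  have [measurable]: "(\<lambda>X. indicator S (X(i := x0)) :: ennreal) \<in> borel_measurable (PiM (I - {i}) M)"
    using S by (intro measurable_compose[OF m]) auto
  have "emeasure (PiM I M) S = (\<integral>\<^sup>+X. indicator S (X(i := x0)) \<partial>PiM (I - {i}) M)"
    using *[of "\<lambda>_. 1"] S by (simp add: i.emeasure_space_1)
  then show ?thesis
    by (subst *[OF h], subst nn_integral_multc) auto
qed

section \<open>Cylinder events and stopping events\<close>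

text \<open>The preimages under restriction to \<open>{1..n}\<close> form a sigma-algebra that
  contains every generator, hence everything generated.\<close>

lemma sets_obs_filtration_cylinder:
  assumes "S \<in> sets (obs_filtration A (enat n))"
  shows "\<exists>B\<in>sets (\<Pi>\<^sub>M i\<in>{1..n}. A). S = (\<lambda>\<omega>. restrict \<omega> {1..n}) -` B \<inter> space (obs_space A)"
proof -
  let ?X = "space (obs_space A)" and ?r = "\<lambda>\<omega>. restrict \<omega> {1..n}"
  let ?V = "vimage_algebra ?X ?r (\<Pi>\<^sub>M i\<in>{1..n}. A)"
  let ?G = "{{\<omega> \<in> ?X. \<omega> i \<in> B} | i B. 1 \<le> i \<and> enat i \<le> enat n \<and> B \<in> sets A}"
  have r: "?r \<in> ?X \<rightarrow> space (\<Pi>\<^sub>M i\<in>{1..n}. A)"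
    by (auto simp: obs_space_def space_PiM)
  have "?G \<subseteq> sets ?V"
  proof safe
    fix i B assume i: "1 \<le> i" "enat i \<le> enat n" and B: "B \<in> sets A"
    have "{\<omega> \<in> space (\<Pi>\<^sub>M i\<in>{1..n}. A). \<omega> i \<in> B} \<in> sets (\<Pi>\<^sub>M i\<in>{1..n}. A)"
      using i B by (intro sets_Collect_single) auto
    then have "?r -` {\<omega> \<in> space (\<Pi>\<^sub>M i\<in>{1..n}. A). \<omega> i \<in> B} \<inter> ?X \<in> sets ?V"
      by (rule in_vimage_algebra)
    also have "?r -` {\<omega> \<in> space (\<Pi>\<^sub>M i\<in>{1..n}. A). \<omega> i \<in> B} \<inter> ?X = {\<omega> \<in> ?X. \<omega> i \<in> B}"
      using r i by (auto simp: Pi_iff)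
    finally show "{\<omega> \<in> ?X. \<omega> i \<in> B} \<in> sets ?V" .
  qed
  then have "sigma_sets ?X ?G \<subseteq> sets ?V"
    using sets.sigma_sets_subset[of ?G ?V] by simp
  moreover have "?G \<subseteq> Pow ?X" by auto
  ultimately have "sets (obs_filtration A (enat n)) \<subseteq> sets ?V"
    unfolding obs_filtration_def by simp
  with assms have "S \<in> sets ?V" by auto
  then show ?thesis
    unfolding sets_vimage_algebra2[OF r] by auto
qed

lemma space_obs_filtration [simp]: "space (obs_filtration A n) = space (obs_space A)"
  unfolding obs_filtration_def by (auto intro!: space_measure_of)

lemma sets_obs_filtration_subset:
  assumes "S \<in> sets (obs_filtration A (enat n))"
  shows "S \<in> sets (obs_space A)"
proof -
  obtain B where B: "B \<in> sets (\<Pi>\<^sub>M i\<in>{1..n}. A)"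
    "S = (\<lambda>\<omega>. restrict \<omega> {1..n}) -` B \<inter> space (obs_space A)"
    using sets_obs_filtration_cylinder[OF assms] by auto
  have "(\<lambda>\<omega>. restrict \<omega> {1..n}) \<in> obs_space A \<rightarrow>\<^sub>M (\<Pi>\<^sub>M i\<in>{1..n}. A)"
    unfolding obs_space_def by (rule measurable_restrict_subset) auto
  then show ?thesis using B by auto
qed

lemma obs_filtration_determined:
  assumes S: "S \<in> sets (obs_filtration A (enat n))"
    and "\<omega> \<in> space (obs_space A)" "\<omega>' \<in> space (obs_space A)"
    and "\<And>i. 1 \<le> i \<Longrightarrow> i \<le> n \<Longrightarrow> \<omega> i = \<omega>' i"
  shows "\<omega> \<in> S \<longleftrightarrow> \<omega>' \<in> S"
proof -
  obtain B where B: "S = (\<lambda>\<omega>. restrict \<omega> {1..n}) -` B \<inter> space (obs_space A)"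
    using sets_obs_filtration_cylinder[OF S] by auto
  have "restrict \<omega> {1..n} = restrict \<omega>' {1..n}"
    using assms(4) by (auto simp: restrict_def)
  then show ?thesis using B assms(2,3) by auto
qed

lemma one_le_obs_stopping_time:
  "obs_stopping_time A T \<Longrightarrow> \<omega> \<in> space (obs_space A) \<Longrightarrow> 1 \<le> T \<omega>"
  by (simp add: obs_stopping_time_def)

lemma sets_stopped_le:
  assumes "obs_stopping_time A T"
  shows "{\<omega> \<in> space (obs_space A). T \<omega> \<le> enat n} \<in> sets (obs_filtration A (enat n))"
  using assms stopping_timeD[of "obs_filtration A" T "enat n"]
  by (simp add: obs_stopping_time_def pred_def)

lemma sets_stopped_greater:
  assumes "obs_stopping_time A T"
  shows "{\<omega> \<in> space (obs_space A). enat n < T \<omega>} \<in> sets (obs_filtration A (enat n))"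
proof -
  have "{\<omega> \<in> space (obs_space A). enat n < T \<omega>}
      = space (obs_filtration A (enat n)) - {\<omega> \<in> space (obs_space A). T \<omega> \<le> enat n}"
    by auto
  then show ?thesis
    using sets.compl_sets[OF sets_stopped_le[OF assms, of n]] by simp
qed

text \<open>For positive \<open>n\<close> the event is the part of \<open>{T \<le> n}\<close>
  outside \<open>{T \<le> n - 1}\<close>, and the filtration increases; \<open>n = 0\<close> has no
  predecessor and is treated apart.\<close>

lemma sets_stopped_at:
  assumes "obs_stopping_time A T"
  shows "{\<omega> \<in> space (obs_space A). T \<omega> = enat n} \<in> sets (obs_filtration A (enat n))"
proof (cases n)
  case 0
  then have "{\<omega> \<in> space (obs_space A). T \<omega> = enat n} = {\<omega> \<in> space (obs_space A). T \<omega> \<le> enat n}"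
    using one_le_obs_stopping_time[OF assms] by (auto simp flip: zero_enat_def)
  then show ?thesis using sets_stopped_le[OF assms, of n] by simp
next
  case (Suc m)
  have mono: "sets (obs_filtration A (enat m)) \<subseteq> sets (obs_filtration A (enat n))"
  proof -
    let ?G = "\<lambda>n. {{\<omega> \<in> space (obs_space A). \<omega> i \<in> B} | i B. 1 \<le> i \<and> enat i \<le> enat n \<and> B \<in> sets A}"
    have "?G m \<subseteq> ?G n" using Suc by fastforce
    moreover have "?G j \<subseteq> Pow (space (obs_space A))" for j by auto
    ultimately show ?thesis
      unfolding obs_filtration_def by (simp add: sigma_sets_mono')
  qed
  have "{\<omega> \<in> space (obs_space A). T \<omega> = enat n}
      = {\<omega> \<in> space (obs_space A). T \<omega> \<le> enat n} \<inter> {\<omega> \<in> space (obs_space A). enat m < T \<omega>}"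
  proof (intro set_eqI)
    fix \<omega>
    show "\<omega> \<in> {\<omega> \<in> space (obs_space A). T \<omega> = enat n} \<longleftrightarrow>
      \<omega> \<in> {\<omega> \<in> space (obs_space A). T \<omega> \<le> enat n} \<inter> {\<omega> \<in> space (obs_space A). enat m < T \<omega>}"
      using Suc by (cases "T \<omega>") auto
  qed
  then show ?thesis
    using sets_stopped_le[OF assms, of n] sets_stopped_greater[OF assms, of m] mono by auto
qed

text \<open>Since \<open>enat\<close> is countable, singletons suffice; the event
  \<open>T = \<infinity>\<close> is the complement of the countably many finite ones.\<close>

lemma measurable_obs_stopping_time:
  assumes T: "obs_stopping_time A T"
  shows "T \<in> obs_space A \<rightarrow>\<^sub>M count_space UNIV"
proof (subst measurable_count_space_eq2_countable, intro conjI)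
  show "T \<in> space (obs_space A) \<rightarrow> UNIV" by simp
  have *: "T -` {enat n} \<inter> space (obs_space A) \<in> sets (obs_space A)" for n
    using sets_obs_filtration_subset[OF sets_stopped_at[OF T, of n]]
    by (auto simp: vimage_def Int_def conj_commute)
  have "T -` {\<infinity>} \<inter> space (obs_space A)
      = space (obs_space A) - (\<Union>n. T -` {enat n} \<inter> space (obs_space A))"
    by auto
  also have "\<dots> \<in> sets (obs_space A)"
    by (intro sets.Diff sets.top sets.countable_UN) (use * in blast)
  finally have "T -` {\<infinity>} \<inter> space (obs_space A) \<in> sets (obs_space A)" .
  with * show "\<forall>a\<in>UNIV. T -` {a} \<inter> space (obs_space A) \<in> sets (obs_space A)"
    by (metis enat.exhaust)
qed

text \<open>Projecting to the first \<open>n\<close> coordinates gives a finite product with all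
  factors \<open>P\<close>. The factors beyond \<open>n\<close> stay free, so that one statement
  serves the laws with and without a change.\<close>

lemma emeasure_PiM_obs_filtration:
  assumes M: "\<And>i. prob_space (M i)" "\<And>i. sets (M i) = sets A" "\<And>i. i \<le> n \<Longrightarrow> M i = P"
    and S: "S \<in> sets (obs_filtration A (enat n))"
    and B: "B \<in> sets (\<Pi>\<^sub>M i\<in>{1..n}. A)" "S = (\<lambda>\<omega>. restrict \<omega> {1..n}) -` B \<inter> space (obs_space A)"
  shows "emeasure (PiM {1..} M) S = emeasure (\<Pi>\<^sub>M i\<in>{1..n}. P) B"
proof -
  interpret product_prob_space M "{1..}"
    by (intro product_prob_spaceI M)
  have sp: "space (PiM {1..} M) = space (obs_space A)"
    unfolding obs_space_def by (intro sets_eq_imp_space_eq sets_PiM_cong) (auto simp: M)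
  have eq: "PiM {1..n} M = (\<Pi>\<^sub>M i\<in>{1..n}. P)"
    by (intro PiM_cong) (auto simp: M)
  have B': "B \<in> sets (PiM {1..n} M)"
    using B(1) M(2) by (simp cong: sets_PiM_cong)
  have "emeasure (distr (PiM {1..} M) (PiM {1..n} M) (\<lambda>\<omega>. restrict \<omega> {1..n})) B
      = emeasure (PiM {1..} M) S"
    using B' by (subst emeasure_distr) (auto simp: B(2) sp[symmetric] intro!: measurable_restrict_subset)
  then show ?thesis
    unfolding eq[symmetric] by (subst (asm) distr_PiM_restrict_finite) auto
qed

section \<open>Laws with and without a change\<close>

locale change_pair =
  P: prob_space P + Q: prob_space Q for A P Q :: "'a measure" +
  assumes sets_P: "sets P = sets A" and sets_Q: "sets Q = sets A"
begin

lemma prob_space_component: "prob_space (if (i::nat) < k then P else Q)"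
  by (simp add: P.prob_space_axioms Q.prob_space_axioms)

lemma prob_space_change_law: "prob_space (change_law P k Q)"
  unfolding change_law_def by (intro prob_space_PiM prob_space_component)

lemma prob_space_no_change_law: "prob_space (no_change_law P)"
  unfolding no_change_law_def by (intro prob_space_PiM P.prob_space_axioms)

lemma sets_change_law [measurable_cong]: "sets (change_law P k Q) = sets (obs_space A)"
  unfolding change_law_def obs_space_def by (intro sets_PiM_cong) (auto simp: sets_P sets_Q)

lemma sets_no_change_law [measurable_cong]: "sets (no_change_law P) = sets (obs_space A)"
  unfolding no_change_law_def obs_space_def by (intro sets_PiM_cong) (auto simp: sets_P)

lemma space_change_law: "space (change_law P k Q) = space (obs_space A)"
  by (rule sets_eq_imp_space_eq[OF sets_change_law])

lemma space_no_change_law: "space (no_change_law P) = space (obs_space A)"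
  by (rule sets_eq_imp_space_eq[OF sets_no_change_law])

text \<open>Both laws have the same marginal on the observations before the change point. This
  carries the false-alarm bounds over to the change law.\<close>

lemma emeasure_change_law_obs_filtration:
  assumes S: "S \<in> sets (obs_filtration A (enat n))" and "n < k"
  shows "emeasure (change_law P k Q) S = emeasure (no_change_law P) S"
proof -
  obtain B where B: "B \<in> sets (\<Pi>\<^sub>M i\<in>{1..n}. A)"
    "S = (\<lambda>\<omega>. restrict \<omega> {1..n}) -` B \<inter> space (obs_space A)"
    using sets_obs_filtration_cylinder[OF S] by auto
  show ?thesis
    unfolding change_law_def no_change_law_def
    using assms(2) by (subst (1 2) emeasure_PiM_obs_filtration[OF _ _ _ S B])
      (auto simp: sets_P sets_Q prob_space_component P.prob_space_axioms)
qed

end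

subsection \<open>Change of measure and Wald's identity\<close>

text \<open>
  Only an inequality is required in \<open>tilt\<close>: \<open>P\<close> may charge the set where \<open>dQ/dP = 0\<close>, and there
  the entropy density has the junk value \<open>ln 0 = 0\<close>.
\<close>

locale change_pair_llr = change_pair A P Q for A P Q :: "'a measure" +
  fixes l :: "'a \<Rightarrow> real"
  assumes l_measurable: "l \<in> borel_measurable A"
    and l_integrable: "integrable Q l"
    and tilt: "h \<in> borel_measurable A \<Longrightarrow>
      (\<integral>\<^sup>+x. h x * ennreal (exp (- l x)) \<partial>Q) \<le> (\<integral>\<^sup>+x. h x \<partial>P)"
begin

lemma measurable_obs_component: "1 \<le> i \<Longrightarrow> (\<lambda>\<omega>. \<omega> i) \<in> obs_space A \<rightarrow>\<^sub>M A"
  unfolding obs_space_def by (rule measurable_component_singleton) simp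

lemma measurable_obs_l [measurable]: "(\<lambda>\<omega>. l (\<omega> (Suc i))) \<in> borel_measurable (obs_space A)"
  by (rule measurable_compose[OF measurable_obs_component l_measurable]) simp

text \<open>Postponing the change by one replaces \<open>Q\<close> by \<open>P\<close> at the single
  coordinate \<open>Suc n\<close>. The weight depends on that coordinate alone, so
  \<open>tilt\<close> applies inside the integral over the others.\<close>

lemma change_law_tilt_step:
  assumes g: "g \<in> borel_measurable (obs_space A)"
  shows "(\<integral>\<^sup>+\<omega>. g \<omega> * ennreal (exp (- l (\<omega> (Suc n)))) \<partial>change_law P (Suc n) Q)
      \<le> (\<integral>\<^sup>+\<omega>. g \<omega> \<partial>change_law P (Suc (Suc n)) Q)"
proof -
  let ?n = "Suc n" and ?I = "{1::nat..}"
  let ?M = "\<lambda>i. if i < Suc n then P else Q" and ?M' = "\<lambda>i. if i < Suc (Suc n) then P else Q"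
  note [measurable] = g
  have law: "change_law P (Suc n) Q = PiM ?I ?M" "change_law P (Suc (Suc n)) Q = PiM ?I ?M'"
    unfolding change_law_def by auto
  have meas: "f \<in> borel_measurable (PiM ?I ?M)" "f \<in> borel_measurable (PiM ?I ?M')"
    if "f \<in> borel_measurable (obs_space A)" for f :: "(nat \<Rightarrow> 'a) \<Rightarrow> ennreal"
    using that measurable_cong_sets[OF sets_change_law refl] unfolding law[symmetric] by blast+
  have rest: "PiM (?I - {?n}) ?M = PiM (?I - {?n}) ?M'"
    by (intro PiM_cong) auto
  have "(\<integral>\<^sup>+\<omega>. g \<omega> * ennreal (exp (- l (\<omega> ?n))) \<partial>PiM ?I ?M)
      = (\<integral>\<^sup>+X. (\<integral>\<^sup>+x. g (X(?n := x)) * ennreal (exp (- l ((X(?n := x)) ?n))) \<partial>?M ?n) \<partial>PiM (?I - {?n}) ?M)"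
    by (rule nn_integral_PiM_split_coordinate[OF prob_space_component _ meas(1)]) auto
  also have "\<dots> = (\<integral>\<^sup>+X. (\<integral>\<^sup>+x. g (X(?n := x)) * ennreal (exp (- l x)) \<partial>Q) \<partial>PiM (?I - {?n}) ?M')"
    unfolding rest by simp
  also have "\<dots> \<le> (\<integral>\<^sup>+X. (\<integral>\<^sup>+x. g (X(?n := x)) \<partial>P) \<partial>PiM (?I - {?n}) ?M')"
  proof (intro nn_integral_mono tilt)
    fix X assume X: "X \<in> space (PiM (?I - {?n}) ?M')"
    have "(\<lambda>x. X(?n := x)) \<in> A \<rightarrow>\<^sub>M obs_space A"
      unfolding obs_space_def
    proof (rule measurable_fun_upd[where J="?I - {?n}"])
      show "{1..} = (?I - {?n}) \<union> {?n}" by auto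
      show "(\<lambda>x. X) \<in> A \<rightarrow>\<^sub>M (\<Pi>\<^sub>M i\<in>?I - {?n}. A)"
      proof (rule measurable_const)
        have "space (PiM (?I - {?n}) ?M') = space (\<Pi>\<^sub>M i\<in>?I - {?n}. A)"
          by (intro sets_eq_imp_space_eq sets_PiM_cong) (auto simp: sets_P sets_Q)
        with X show "X \<in> space (\<Pi>\<^sub>M i\<in>?I - {?n}. A)" by simp
      qed
    qed simp
    then show "(\<lambda>x. g (X(?n := x))) \<in> borel_measurable A"
      by (rule measurable_compose) (rule g)
  qed
  also have "\<dots> = (\<integral>\<^sup>+X. (\<integral>\<^sup>+x. g (X(?n := x)) \<partial>?M' ?n) \<partial>PiM (?I - {?n}) ?M')"
    by simp
  also have "\<dots> = (\<integral>\<^sup>+\<omega>. g \<omega> \<partial>PiM ?I ?M')"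
    by (rule nn_integral_PiM_split_coordinate[OF prob_space_component _ meas(2)[OF g], symmetric]) auto
  finally show ?thesis unfolding law .
qed

text \<open>The one-step inequality is iterated; index \<open>i\<close> stands for observation
  \<open>Suc i\<close>, so the weight involves the observations \<open>t + 1\<close> to
  \<open>n\<close>.\<close>

lemma change_law_tilt:
  assumes "t \<le> n" and g: "g \<in> borel_measurable (obs_space A)"
  shows "(\<integral>\<^sup>+\<omega>. g \<omega> * ennreal (exp (- (\<Sum>i\<in>{t..<n}. l (\<omega> (Suc i))))) \<partial>change_law P (Suc t) Q)
      \<le> (\<integral>\<^sup>+\<omega>. g \<omega> \<partial>change_law P (Suc n) Q)"
  using assms
proof (induction n arbitrary: g rule: dec_induct)
  case base
  then show ?case by simp
next
  \<comment> \<open>The newest factor is absorbed into the integrand, which is why \<open>g\<close>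
    is arbitrary in the induction; one further postponement of the change then removes it.\<close>
  case (step n)
  note [measurable] = step.prems
  have "(\<integral>\<^sup>+\<omega>. g \<omega> * ennreal (exp (- (\<Sum>i\<in>{t..<Suc n}. l (\<omega> (Suc i))))) \<partial>change_law P (Suc t) Q)
      = (\<integral>\<^sup>+\<omega>. (g \<omega> * ennreal (exp (- l (\<omega> (Suc n)))))
          * ennreal (exp (- (\<Sum>i\<in>{t..<n}. l (\<omega> (Suc i))))) \<partial>change_law P (Suc t) Q)"
    using step.hyps by (intro nn_integral_cong) (simp add: exp_diff exp_minus field_simps
      flip: ennreal_mult' exp_add)
  also have "\<dots> \<le> (\<integral>\<^sup>+\<omega>. g \<omega> * ennreal (exp (- l (\<omega> (Suc n)))) \<partial>change_law P (Suc n) Q)"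
    by (rule step.IH) measurable
  also have "\<dots> \<le> (\<integral>\<^sup>+\<omega>. g \<omega> \<partial>change_law P (Suc (Suc n)) Q)"
    by (rule change_law_tilt_step) (rule step.prems)
  finally show ?case .
qed

text \<open>An event of the first \<open>j\<close> observations is independent of observation
  \<open>j + 1\<close>, which has law \<open>Q\<close> because the change at \<open>t + 1\<close>
  has already happened.\<close>

lemma nn_integral_indep_obs:
  fixes h :: "'a \<Rightarrow> ennreal"
  assumes S: "S \<in> sets (obs_filtration A (enat j))" and "t \<le> j" and h: "h \<in> borel_measurable A"
  shows "(\<integral>\<^sup>+\<omega>. indicator S \<omega> * h (\<omega> (Suc j)) \<partial>change_law P (Suc t) Q)
      = emeasure (change_law P (Suc t) Q) S * (\<integral>\<^sup>+x. h x \<partial>Q)"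
proof -
  let ?M = "\<lambda>i. if i < Suc t then P else Q"
  have law: "change_law P (Suc t) Q = PiM {1..} ?M"
    unfolding change_law_def by simp
  have MQ: "?M (Suc j) = Q" using \<open>t \<le> j\<close> by simp
  have "(\<integral>\<^sup>+\<omega>. indicator S \<omega> * h (\<omega> (Suc j)) \<partial>PiM {1..} ?M)
      = emeasure (PiM {1..} ?M) S * (\<integral>\<^sup>+x. h x \<partial>?M (Suc j))"
  proof (rule nn_integral_indep_coordinate)
    show "h \<in> borel_measurable (?M (Suc j))"
      using h measurable_cong_sets[OF sets_Q refl] unfolding MQ by blast
    show "S \<in> sets (PiM {1..} ?M)"
      using sets_obs_filtration_subset[OF S] unfolding law[symmetric] by (simp add: sets_change_law)
    show "\<omega> \<in> S \<longleftrightarrow> \<omega>' \<in> S" if "\<omega> \<in> space (PiM {1..} ?M)" "\<omega>' \<in> space (PiM {1..} ?M)"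
      "\<And>i. i \<noteq> Suc j \<Longrightarrow> \<omega> i = \<omega>' i" for \<omega> \<omega>'
      using that unfolding law[symmetric] space_change_law
      by (intro obs_filtration_determined[OF S]) (use \<open>t \<le> j\<close> in auto)
  qed (auto intro!: prob_space_component[of _ "Suc t"] simp: P.prob_space_axioms Q.prob_space_axioms)
  then show ?thesis unfolding law MQ .
qed

text \<open>This is one summand of Wald's identity, used with \<open>S = {T > j}\<close>. Positive
  and negative parts of \<open>l\<close> factor separately, which gives integrability as well as the
  value.\<close>

lemma integral_indep_obs:
  assumes S: "S \<in> sets (obs_filtration A (enat j))" and "t \<le> j"
  shows "integrable (change_law P (Suc t) Q) (\<lambda>\<omega>. indicator S \<omega> * l (\<omega> (Suc j)))"
    and "(\<integral>\<omega>. indicator S \<omega> * l (\<omega> (Suc j)) \<partial>change_law P (Suc t) Q)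
      = measure (change_law P (Suc t) Q) S * (\<integral>x. l x \<partial>Q)"
proof -
  let ?L = "change_law P (Suc t) Q" and ?f = "\<lambda>\<omega>. indicator S \<omega> * l (\<omega> (Suc j))"
  interpret L: prob_space ?L by (rule prob_space_change_law)
  note [measurable] = l_measurable sets_obs_filtration_subset[OF S]
  have f: "?f \<in> borel_measurable ?L" by measurable
  have p: "(\<integral>\<^sup>+\<omega>. ennreal (?f \<omega>) \<partial>?L) = emeasure ?L S * (\<integral>\<^sup>+x. ennreal (l x) \<partial>Q)"
    by (subst nn_integral_indep_obs[OF assms, symmetric]) (auto intro!: nn_integral_cong simp: indicator_def)
  have n: "(\<integral>\<^sup>+\<omega>. ennreal (- ?f \<omega>) \<partial>?L) = emeasure ?L S * (\<integral>\<^sup>+x. ennreal (- l x) \<partial>Q)"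
    by (subst nn_integral_indep_obs[OF assms, symmetric]) (auto intro!: nn_integral_cong simp: indicator_def)
  show int: "integrable ?L ?f"
    using l_integrable f unfolding real_integrable_def p n
    by (auto simp: ennreal_mult_eq_top_iff L.emeasure_eq_measure)
  show "(\<integral>\<omega>. ?f \<omega> \<partial>?L) = measure ?L S * (\<integral>x. l x \<partial>Q)"
    unfolding real_lebesgue_integral_def[OF int] real_lebesgue_integral_def[OF l_integrable] p n
    by (simp add: enn2real_mult measure_def algebra_simps)
qed

end

text \<open>Splitting by the value of \<open>T\<close> turns the randomly stopped weight into
  weights of fixed length \<open>n\<close>, to which the change of measure applies term by term.
  Here \<open>f j\<close> stands for the log-likelihood ratio of observation
  \<open>j + 1\<close>.\<close>

lemma obs_stopping_time_path_sum:
  fixes f :: "nat \<Rightarrow> real" and c :: real and T :: enat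
  shows "(if enat t < T then ennreal (exp ((if T \<le> enat (t + M) then c else 0)
           - (\<Sum>j\<in>{t..<t+M}. if enat j < T then f j else 0))) else 0)
    = (\<Sum>n\<in>{t<..t+M}. if T = enat n then ennreal (exp c) * ennreal (exp (- (\<Sum>j\<in>{t..<n}. f j))) else 0)
      + (if enat (t + M) < T then ennreal (exp (- (\<Sum>j\<in>{t..<t+M}. f j))) else 0)"
proof (cases "enat (t + M) < T")
  case True
  then have *: "enat j < T" if "j \<le> t + M" for j
    using that by (metis enat_ord_simps(1) le_less_trans)
  have "(\<Sum>j\<in>{t..<t+M}. if enat j < T then f j else 0) = (\<Sum>j\<in>{t..<t+M}. f j)"
    using * by (intro sum.cong) auto
  moreover have "(\<Sum>n\<in>{t<..t+M}. if T = enat n then ennreal (exp c) * ennreal (exp (- (\<Sum>j\<in>{t..<n}. f j))) else 0) = 0"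
    using True by (intro sum.neutral) auto
  moreover have "\<not> T \<le> enat (t + M)" using True by simp
  ultimately show ?thesis using True *[of t] by auto
next
  case False
  then obtain n where n: "T = enat n" "n \<le> t + M" by (cases T) auto
  show ?thesis
  proof (cases "t < n")
    case True
    have "(\<Sum>j\<in>{t..<t+M}. if enat j < T then f j else 0) = (\<Sum>j\<in>{t..<n}. f j)"
      using n by (intro sum.mono_neutral_cong_right) auto
    then show ?thesis using n True
      by (simp add: exp_diff exp_minus divide_inverse ennreal_mult' cong: if_cong)
  next
    case False
    then show ?thesis using n by (auto intro!: sum.neutral)
  qed
qed

subsection \<open>The non-asymptotic delay bound\<close>

text \<open>This is telescoping with stride \<open>M\<close>: only the first \<open>M\<close> terms
  and the \<open>M\<close> terms from index \<open>n\<close> on survive.\<close>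

lemma sum_diff_shift:
  fixes a :: "nat \<Rightarrow> real"
  shows "(\<Sum>t<n. a t - a (t + M)) = (\<Sum>t<M. a t) - (\<Sum>t<M. a (t + n))"
proof (induction n)
  case (Suc n)
  have "(\<Sum>t<M. a (Suc t + n) - a (t + n)) = a (M + n) - a n"
    using sum_lessThan_telescope[of "\<lambda>t. a (t + n)" M] by simp
  then have "(\<Sum>t<M. a (t + Suc n)) = (\<Sum>t<M. a (t + n)) + a (n + M) - a n"
    by (simp add: sum_subtractf add.commute)
  with Suc show ?case by simp
qed simp

section \<open>Choice of the window and tail sums of the delay\<close>

context change_pair
begin

text \<open>If every window violated the bound, telescoping would give
  \<open>\<Sum>\<^sub>t P(T > t) \<le> \<gamma> / 2\<close>, against the run length constraint. The
  factor 2 supplies the strict contradiction.\<close>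

lemma exists_rarely_stopping_window:
  assumes T: "obs_stopping_time A T" and "0 < \<gamma>" and "1 \<le> M"
    and arl: "ennreal \<gamma> \<le> (\<integral>\<^sup>+\<omega>. ennreal_of_enat (T \<omega>) \<partial>no_change_law P)"
  shows "\<exists>t. measure (no_change_law P) {\<omega> \<in> space (obs_space A). enat t < T \<omega>}
      - measure (no_change_law P) {\<omega> \<in> space (obs_space A). enat (t + M) < T \<omega>}
      < 2 * real M / \<gamma> * measure (no_change_law P) {\<omega> \<in> space (obs_space A). enat t < T \<omega>}"
proof (rule ccontr)
  let ?N = "no_change_law P"
  define a where "a t = measure ?N {\<omega> \<in> space (obs_space A). enat t < T \<omega>}" for t
  interpret N: prob_space ?N by (rule prob_space_no_change_law)
  assume "\<not> ?thesis"
  then have le: "2 * real M / \<gamma> * a t \<le> a t - a (t + M)" for t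
    by (simp add: not_less a_def)
  have "(\<Sum>t<n. a t) \<le> \<gamma> / 2" for n
  proof -
    have "2 * real M / \<gamma> * (\<Sum>t<n. a t) \<le> (\<Sum>t<n. a t - a (t + M))"
      unfolding sum_distrib_left by (intro sum_mono le)
    also have "\<dots> \<le> (\<Sum>t<M. a t)"
      unfolding sum_diff_shift by (simp add: sum_nonneg a_def)
    also have "\<dots> \<le> (\<Sum>t<M. 1)"
      by (intro sum_mono) (simp add: a_def)
    finally show ?thesis using \<open>0 < \<gamma>\<close> \<open>1 \<le> M\<close> by (simp add: field_simps)
  qed
  then have "(\<Sum>t. ennreal (a t)) \<le> ennreal (\<gamma> / 2)"
    by (intro suminf_le_const) (auto simp: sum_ennreal a_def simp flip: ennreal_le_iff2 intro!: ennreal_leI)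
  moreover have "(\<integral>\<^sup>+\<omega>. ennreal_of_enat (T \<omega>) \<partial>?N) = (\<Sum>t. ennreal (a t))"
    using measurable_obs_stopping_time[OF T] measurable_cong_sets[OF sets_no_change_law refl]
    by (subst nn_integral_enat_function) (auto simp: a_def N.emeasure_eq_measure space_no_change_law)
  ultimately have "ennreal \<gamma> \<le> ennreal (\<gamma> / 2)"
    using arl by simp
  then show False using \<open>0 < \<gamma>\<close> by simp
qed

text \<open>The conditional delay is the sum over all \<open>i\<close> of
  \<open>P(T > t + i | T > t)\<close>; keeping the first \<open>M\<close> terms gives the lower
  bound.\<close>

lemma cond_delay_ge:
  assumes T: "obs_stopping_time A T"
  defines "G \<equiv> \<lambda>j. {\<omega> \<in> space (obs_space A). enat j < T \<omega>}"
  assumes pos: "0 < measure (change_law P (Suc t) Q) (G t)"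
  shows "ennreal ((\<Sum>j\<in>{t..<t+M}. measure (change_law P (Suc t) Q) (G j))
      / measure (change_law P (Suc t) Q) (G t)) \<le> cond_delay P (Suc t) Q T"
proof -
  let ?L = "change_law P (Suc t) Q"
  let ?U = "uniform_measure ?L (G t)"
  interpret L: prob_space ?L by (rule prob_space_change_law)
  have G: "G j \<in> sets ?L" for j
    using sets_obs_filtration_subset[OF sets_stopped_greater[OF T]] by (simp add: G_def sets_change_law)
  \<comment> \<open>With the change at \<open>t + 1\<close>, the conditioning event
    \<open>T \<ge> t + 1\<close> is \<open>T > t\<close>, and the delay is
    \<open>T - t\<close>.\<close>
  have nys: "not_yet_stopped P (Suc t) Q T = G t"
    by (auto simp: not_yet_stopped_def G_def space_change_law Suc_ile_eq)
  have sub: "G (i + t) \<subseteq> G t" for i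
  proof
    fix \<omega> assume "\<omega> \<in> G (i + t)"
    then show "\<omega> \<in> G t" by (cases "T \<omega>") (auto simp: G_def)
  qed
  have "(\<Sum>j\<in>{t..<t+M}. measure ?L (G j)) = (\<Sum>i<M. measure ?L (G (i + t)))"
    using sum.shift_bounds_nat_ivl[of "\<lambda>j. measure ?L (G j)" 0 t M]
    by (simp add: add.commute atLeast0LessThan)
  then have "ennreal ((\<Sum>j\<in>{t..<t+M}. measure ?L (G j)) / measure ?L (G t))
      = (\<Sum>i<M. ennreal (measure ?L (G (i + t)) / measure ?L (G t)))"
    by (simp add: sum_divide_distrib)
  also have "\<dots> = (\<Sum>i<M. emeasure ?U (G (i + t)))"
  proof (intro sum.cong refl)
    fix i
    have "G t \<inter> G (i + t) = G (i + t)" using sub by auto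
    then show "ennreal (measure ?L (G (i + t)) / measure ?L (G t)) = emeasure ?U (G (i + t))"
      using G pos by (simp add: L.emeasure_eq_measure divide_ennreal)
  qed
  also have "\<dots> \<le> (\<Sum>i. emeasure ?U (G (i + t)))"
    by (intro sum_le_suminf) auto
  also have "\<dots> = (\<Sum>i. emeasure ?U {\<omega> \<in> space ?U. enat i < T \<omega> + 1 - enat (Suc t)})"
  proof (intro suminf_cong arg_cong[where f="emeasure ?U"])
    fix i
    have "enat (i + t) < T \<omega> \<longleftrightarrow> enat i < T \<omega> + 1 - enat (Suc t)" for \<omega>
      by (cases "T \<omega>") (auto simp: one_enat_def)
    then show "G (i + t) = {\<omega> \<in> space ?U. enat i < T \<omega> + 1 - enat (Suc t)}"
      by (simp add: G_def space_change_law)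
  qed
  also have "\<dots> = (\<integral>\<^sup>+\<omega>. ennreal_of_enat (T \<omega> + 1 - enat (Suc t)) \<partial>?U)"
  proof (rule nn_integral_enat_function[symmetric])
    have "T \<in> ?U \<rightarrow>\<^sub>M count_space UNIV"
      using measurable_obs_stopping_time[OF T] measurable_cong_sets[OF sets_change_law refl] by auto
    then show "(\<lambda>\<omega>. T \<omega> + 1 - enat (Suc t)) \<in> ?U \<rightarrow>\<^sub>M count_space UNIV"
      by (rule measurable_compose) simp
  qed
  finally show ?thesis unfolding cond_delay_def nys .
qed

end

section \<open>Tilting at the stopping time and the resulting bound\<close>

context change_pair_llr
begin

text \<open>Each piece of the pathwise decomposition is an event known at its own time
  \<open>n\<close>. Tilting moves the change to \<open>n + 1\<close>, where that event has its
  no-change probability.\<close>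

lemma nn_integral_stopped_tilt_le:
  fixes c :: real
  assumes T: "obs_stopping_time A T"
  defines "G \<equiv> \<lambda>j. {\<omega> \<in> space (obs_space A). enat j < T \<omega>}"
  shows "(\<integral>\<^sup>+\<omega>. (if enat t < T \<omega> then ennreal (exp ((if T \<omega> \<le> enat (t + M) then c else 0)
           - (\<Sum>j\<in>{t..<t+M}. if enat j < T \<omega> then l (\<omega> (Suc j)) else 0))) else 0) \<partial>change_law P (Suc t) Q)
    \<le> ennreal (exp c * (measure (no_change_law P) (G t) - measure (no_change_law P) (G (t + M)))
        + measure (no_change_law P) (G (t + M)))"
proof -
  let ?L = "change_law P (Suc t) Q" and ?N = "no_change_law P"
  define S where "S n = {\<omega> \<in> space (obs_space A). T \<omega> = enat n}" for n
  interpret N: prob_space ?N by (rule prob_space_no_change_law)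
  have SF: "S n \<in> sets (obs_filtration A (enat n))" for n
    unfolding S_def by (rule sets_stopped_at[OF T])
  have GF: "G n \<in> sets (obs_filtration A (enat n))" for n
    unfolding G_def by (rule sets_stopped_greater[OF T])
  have [measurable]: "S n \<in> sets (obs_space A)" "G n \<in> sets (obs_space A)" for n
    using sets_obs_filtration_subset[OF SF] sets_obs_filtration_subset[OF GF] .
  have tilted: "(\<integral>\<^sup>+\<omega>. indicator B \<omega> * ennreal (exp (- (\<Sum>j\<in>{t..<n}. l (\<omega> (Suc j))))) \<partial>?L)
      \<le> ennreal (measure ?N B)" if B: "B \<in> sets (obs_filtration A (enat n))" and "t \<le> n" for B n
  proof -
    have [measurable]: "B \<in> sets (obs_space A)" using sets_obs_filtration_subset[OF B] .
    have "(\<integral>\<^sup>+\<omega>. indicator B \<omega> * ennreal (exp (- (\<Sum>j\<in>{t..<n}. l (\<omega> (Suc j))))) \<partial>?L)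
        \<le> (\<integral>\<^sup>+\<omega>. indicator B \<omega> \<partial>change_law P (Suc n) Q)"
      by (rule change_law_tilt) (use that in auto)
    also have "\<dots> = emeasure (change_law P (Suc n) Q) B"
      by (rule nn_integral_indicator) (simp add: sets_change_law)
    also have "\<dots> = emeasure ?N B"
      by (rule emeasure_change_law_obs_filtration[OF B]) simp
    finally show ?thesis by (simp add: N.emeasure_eq_measure)
  qed
  have "(\<integral>\<^sup>+\<omega>. (if enat t < T \<omega> then ennreal (exp ((if T \<omega> \<le> enat (t + M) then c else 0)
           - (\<Sum>j\<in>{t..<t+M}. if enat j < T \<omega> then l (\<omega> (Suc j)) else 0))) else 0) \<partial>?L)
    = (\<integral>\<^sup>+\<omega>. (\<Sum>n\<in>{t<..t+M}. ennreal (exp c) *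
            (indicator (S n) \<omega> * ennreal (exp (- (\<Sum>j\<in>{t..<n}. l (\<omega> (Suc j)))))))
        + indicator (G (t + M)) \<omega> * ennreal (exp (- (\<Sum>j\<in>{t..<t+M}. l (\<omega> (Suc j))))) \<partial>?L)"
    unfolding obs_stopping_time_path_sum
    by (intro nn_integral_cong arg_cong2[where f="(+)"] sum.cong refl)
      (auto simp: S_def G_def space_change_law indicator_def)
  also have "\<dots> = (\<Sum>n\<in>{t<..t+M}. ennreal (exp c) *
            (\<integral>\<^sup>+\<omega>. indicator (S n) \<omega> * ennreal (exp (- (\<Sum>j\<in>{t..<n}. l (\<omega> (Suc j))))) \<partial>?L))
        + (\<integral>\<^sup>+\<omega>. indicator (G (t + M)) \<omega> * ennreal (exp (- (\<Sum>j\<in>{t..<t+M}. l (\<omega> (Suc j))))) \<partial>?L)"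
    by (simp add: nn_integral_add nn_integral_sum nn_integral_cmult)
  also have "\<dots> \<le> (\<Sum>n\<in>{t<..t+M}. ennreal (exp c) * ennreal (measure ?N (S n))) + ennreal (measure ?N (G (t + M)))"
    by (intro add_mono sum_mono mult_left_mono tilted SF GF) auto
  also have "\<dots> = ennreal (exp c * (\<Sum>n\<in>{t<..t+M}. measure ?N (S n)) + measure ?N (G (t + M)))"
    by (simp add: sum_nonneg sum_distrib_left flip: ennreal_mult)
  also have "(\<Sum>n\<in>{t<..t+M}. measure ?N (S n)) = measure ?N (\<Union>n\<in>{t<..t+M}. S n)"
  proof (rule N.finite_measure_finite_Union[symmetric])
    show "S ` {t<..t+M} \<subseteq> N.events" by (auto simp: sets_no_change_law)
    show "disjoint_family_on S {t<..t+M}" by (auto simp: disjoint_family_on_def S_def)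
  qed simp
  also have "(\<Union>n\<in>{t<..t+M}. S n) = G t - G (t + M)"
  proof (intro set_eqI)
    fix \<omega> show "\<omega> \<in> (\<Union>n\<in>{t<..t+M}. S n) \<longleftrightarrow> \<omega> \<in> G t - G (t + M)"
      by (cases "T \<omega>") (auto simp: S_def G_def)
  qed
  also have "measure ?N (G t - G (t + M)) = measure ?N (G t) - measure ?N (G (t + M))"
  proof (rule N.finite_measure_Diff)
    show "G (t + M) \<subseteq> G t"
    proof
      fix \<omega> assume "\<omega> \<in> G (t + M)"
      then show "\<omega> \<in> G t" by (cases "T \<omega>") (auto simp: G_def)
    qed
  qed (auto simp: sets_no_change_law)
  finally show ?thesis .
qed

text \<open>All terms are kept multiplied by \<open>P(T > t)\<close>, so the argument runs under the
  unconditioned change law.\<close>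

lemma information_delay_bound:
  assumes T: "obs_stopping_time A T" and "0 < c"
  defines "G \<equiv> \<lambda>j. {\<omega> \<in> space (obs_space A). enat j < T \<omega>}"
  assumes rare: "measure (no_change_law P) (G t) - measure (no_change_law P) (G (t + M))
      \<le> c * measure (no_change_law P) (G t)"
  shows "ln (1 / c) * (measure (change_law P (Suc t) Q) (G t) - measure (change_law P (Suc t) Q) (G (t + M)))
      - (\<integral>x. l x \<partial>Q) * (\<Sum>j\<in>{t..<t+M}. measure (change_law P (Suc t) Q) (G j))
      \<le> ln 2 * measure (change_law P (Suc t) Q) (G t)"
proof -
  let ?L = "change_law P (Suc t) Q" and ?N = "no_change_law P" and ?b = "ln (1 / c)"
  interpret L: prob_space ?L by (rule prob_space_change_law)
  interpret N: prob_space ?N by (rule prob_space_no_change_law)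
  have GF: "G n \<in> sets (obs_filtration A (enat n))" for n
    unfolding G_def by (rule sets_stopped_greater[OF T])
  have [measurable]: "G n \<in> sets (obs_space A)" for n
    using sets_obs_filtration_subset[OF GF] .
  have same: "measure ?N (G t) = measure ?L (G t)"
    unfolding measure_def by (subst emeasure_change_law_obs_filtration[OF GF]) auto
  have sub: "G j \<subseteq> G t" if "t \<le> j" for j
  proof
    fix \<omega> assume "\<omega> \<in> G j"
    with that show "\<omega> \<in> G t" by (cases "T \<omega>") (auto simp: G_def)
  qed
  \<comment> \<open>\<open>Z\<close> is the log-likelihood ratio stopped at
    \<open>min T (t + M)\<close>; the indicators of \<open>{T > j}\<close> make its mean a sum of
    independent products, which is Wald's identity.\<close>
  define Z where "Z \<omega> = (\<Sum>j\<in>{t..<t+M}. indicator (G j) \<omega> * l (\<omega> (Suc j)))" for \<omega>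
  define X where "X \<omega> = ?b * (indicator (G t) \<omega> - indicator (G (t + M)) \<omega>) - Z \<omega>" for \<omega>
  have Zi: "integrable ?L Z"
    unfolding Z_def by (intro Bochner_Integration.integrable_sum integral_indep_obs(1)[OF GF]) auto
  have "(\<integral>\<omega>. Z \<omega> \<partial>?L) = (\<Sum>j\<in>{t..<t+M}. \<integral>\<omega>. indicator (G j) \<omega> * l (\<omega> (Suc j)) \<partial>?L)"
    unfolding Z_def by (intro Bochner_Integration.integral_sum integral_indep_obs(1)[OF GF]) auto
  also have "\<dots> = (\<Sum>j\<in>{t..<t+M}. measure ?L (G j) * (\<integral>x. l x \<partial>Q))"
    by (intro sum.cong integral_indep_obs(2)[OF GF]) auto
  finally have EZ: "(\<integral>\<omega>. Z \<omega> \<partial>?L) = (\<integral>x. l x \<partial>Q) * (\<Sum>j\<in>{t..<t+M}. measure ?L (G j))"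
    by (simp add: sum_distrib_left mult.commute)
  have Gi: "integrable ?L (indicator (G j) :: _ \<Rightarrow> real)" for j
    by (simp add: sets_change_law L.emeasure_eq_measure)
  have X: "integrable ?L X"
    "(\<integral>\<omega>. X \<omega> \<partial>?L) = ?b * (measure ?L (G t) - measure ?L (G (t + M)))
        - (\<integral>x. l x \<partial>Q) * (\<Sum>j\<in>{t..<t+M}. measure ?L (G j))"
    unfolding X_def using Zi EZ Gi by (auto simp: sets_change_law)
  \<comment> \<open>Off \<open>G t\<close> the variable \<open>X\<close> vanishes and its
    exponential would be 1, hence the indicator.\<close>
  define Y where "Y \<omega> = indicator (G t) \<omega> * exp (X \<omega>)" for \<omega>
  have XM: "X \<in> borel_measurable ?L" using X by auto
  have YM: "Y \<in> borel_measurable ?L" unfolding Y_def[abs_def] using XM by measurable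
  have "(\<integral>\<^sup>+\<omega>. ennreal (Y \<omega>) \<partial>?L)
      = (\<integral>\<^sup>+\<omega>. (if enat t < T \<omega> then ennreal (exp ((if T \<omega> \<le> enat (t + M) then ?b else 0)
           - (\<Sum>j\<in>{t..<t+M}. if enat j < T \<omega> then l (\<omega> (Suc j)) else 0))) else 0) \<partial>?L)"
  proof (rule nn_integral_cong)
    fix \<omega> assume "\<omega> \<in> space ?L"
    then have \<omega>: "\<omega> \<in> G j \<longleftrightarrow> enat j < T \<omega>" for j
      by (simp add: G_def space_change_law)
    have "Z \<omega> = (\<Sum>j\<in>{t..<t+M}. if enat j < T \<omega> then l (\<omega> (Suc j)) else 0)"
      unfolding Z_def by (intro sum.cong) (auto simp: \<omega> indicator_def)
    moreover have "T \<omega> \<le> enat (t + M) \<longleftrightarrow> \<omega> \<notin> G (t + M)"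
      by (simp add: \<omega> not_less)
    ultimately show "ennreal (Y \<omega>) = (if enat t < T \<omega> then ennreal (exp ((if T \<omega> \<le> enat (t + M) then ?b else 0)
           - (\<Sum>j\<in>{t..<t+M}. if enat j < T \<omega> then l (\<omega> (Suc j)) else 0))) else 0)"
      unfolding Y_def X_def \<omega>[symmetric] by (simp add: indicator_def)
  qed
  also have "\<dots> \<le> ennreal (exp ?b * (measure ?N (G t) - measure ?N (G (t + M))) + measure ?N (G (t + M)))"
    unfolding G_def by (rule nn_integral_stopped_tilt_le[OF T])
  \<comment> \<open>The factor \<open>exp ?b = 1 / c\<close> cancels the \<open>c\<close> of the
    rare window; false alarms and survivors contribute at most \<open>P(T > t)\<close> each.\<close>
  also have "\<dots> \<le> ennreal (2 * measure ?L (G t))"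
  proof (rule ennreal_leI)
    have "exp ?b * (measure ?N (G t) - measure ?N (G (t + M))) \<le> exp ?b * (c * measure ?N (G t))"
      using rare by (intro mult_left_mono) auto
    also have "\<dots> = measure ?N (G t)"
      using \<open>0 < c\<close> by simp
    finally show "exp ?b * (measure ?N (G t) - measure ?N (G (t + M))) + measure ?N (G (t + M))
        \<le> 2 * measure ?L (G t)"
      using N.finite_measure_mono[OF sub[of "t + M"]] same by (simp add: sets_no_change_law)
  qed
  finally have Yle: "(\<integral>\<^sup>+\<omega>. ennreal (Y \<omega>) \<partial>?L) \<le> ennreal (2 * measure ?L (G t))" .
  have Y: "integrable ?L Y"
    using YM Yle by (intro integrableI_nonneg) (auto simp: Y_def intro: le_less_trans)
  have Yint: "(\<integral>\<omega>. Y \<omega> \<partial>?L) \<le> 2 * measure ?L (G t)"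
    by (rule integral_real_bounded[OF _ Yle]) simp
  have "(\<integral>\<omega>. X \<omega> \<partial>?L) \<le> (\<integral>\<omega>. (ln 2 - 1) * indicator (G t) \<omega> + Y \<omega> / 2 \<partial>?L)"
  proof (rule integral_mono)
    show "integrable ?L (\<lambda>\<omega>. (ln 2 - 1) * indicator (G t) \<omega> + Y \<omega> / 2)"
      using Gi Y by auto
    fix \<omega>
    show "X \<omega> \<le> (ln 2 - 1) * indicator (G t) \<omega> + Y \<omega> / 2"
    proof (cases "\<omega> \<in> G t")
      case True
      \<comment> \<open>the tangent line of \<open>exp\<close> at \<open>ln 2\<close> takes the place of Jensen's inequality\<close>
      have "1 + (X \<omega> - ln 2) \<le> exp (X \<omega> - ln 2)"
        by (rule exp_ge_add_one_self)
      with True show ?thesis by (simp add: Y_def exp_diff)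
    next
      case False
      then have "\<omega> \<notin> G j" if "t \<le> j" for j using sub[OF that] by auto
      then show ?thesis by (simp add: X_def Y_def Z_def)
    qed
  qed (rule X)
  also have "\<dots> = (ln 2 - 1) * measure ?L (G t) + (\<integral>\<omega>. Y \<omega> \<partial>?L) / 2"
    using Gi Y by (simp add: sets_change_law)
  \<comment> \<open>Half the bound on the integral of \<open>Y\<close> cancels the
    \<open>- 1\<close> in the tangent line.\<close>
  also have "\<dots> \<le> ln 2 * measure ?L (G t)"
    using Yint by (simp add: algebra_simps)
  finally show ?thesis unfolding X(2) .
qed

text \<open>The information bound with \<open>c = 2M / \<gamma>\<close> is divided by
  \<open>P(T > t)\<close>. Markov's inequality eliminates the survival probability \<open>r\<close>,
  and the result is solved for the truncated delay \<open>S\<close>.\<close>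

lemma CADD_lower_bound:
  assumes T: "obs_stopping_time A T" and "P \<in> \<P>"
    and arl: "ennreal \<gamma> \<le> (\<integral>\<^sup>+\<omega>. ennreal_of_enat (T \<omega>) \<partial>no_change_law P)"
    and M: "1 \<le> M" and \<gamma>: "2 * real M \<le> \<gamma>" and I: "0 < (\<integral>x. l x \<partial>Q)"
  shows "ennreal ((ln (\<gamma> / (2 * real M)) - ln 2) / ((\<integral>x. l x \<partial>Q) + ln (\<gamma> / (2 * real M)) / real M))
      \<le> CADD \<P> Q T"
proof -
  let ?I = "\<integral>x. l x \<partial>Q" and ?N = "no_change_law P" and ?b = "ln (\<gamma> / (2 * real M))"
  define G where "G j = {\<omega> \<in> space (obs_space A). enat j < T \<omega>}" for j
  interpret N: prob_space ?N by (rule prob_space_no_change_law)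
  have "0 < \<gamma>" using M \<gamma> by linarith
  have b: "0 \<le> ?b" using M \<gamma> by simp
  obtain t where t: "measure ?N (G t) - measure ?N (G (t + M)) < 2 * real M / \<gamma> * measure ?N (G t)"
    using exists_rarely_stopping_window[OF T \<open>0 < \<gamma>\<close> M arl] unfolding G_def by auto
  let ?L = "change_law P (Suc t) Q"
  interpret L: prob_space ?L by (rule prob_space_change_law)
  have GF: "G n \<in> sets (obs_filtration A (enat n))" for n
    unfolding G_def by (rule sets_stopped_greater[OF T])
  have GL: "G n \<in> sets ?L" and GN: "G n \<in> sets ?N" for n
    using sets_obs_filtration_subset[OF GF] by (auto simp: sets_change_law sets_no_change_law)
  have mono: "G j \<subseteq> G i" if "i \<le> j" for i j
  proof
    fix \<omega> assume "\<omega> \<in> G j"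
    with that show "\<omega> \<in> G i" by (cases "T \<omega>") (auto simp: G_def)
  qed
  have same: "measure ?N (G t) = measure ?L (G t)"
    unfolding measure_def by (subst emeasure_change_law_obs_filtration[OF GF]) auto
  \<comment> \<open>The strict inequality for the window would read \<open>0 < 0\<close> if
    \<open>T > t\<close> had probability zero.\<close>
  have "measure ?N (G t) \<noteq> 0"
  proof
    assume 0: "measure ?N (G t) = 0"
    then have "measure ?N (G (t + M)) \<le> 0"
      using N.finite_measure_mono[OF mono GN, of t "t + M"] by simp
    with t 0 show False using measure_nonneg[of ?N "G (t + M)"] by simp
  qed
  then have pos: "0 < measure ?L (G t)"
    using same measure_nonneg[of ?N "G t"] by linarith
  define S where "S = (\<Sum>j\<in>{t..<t+M}. measure ?L (G j)) / measure ?L (G t)"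
  define r where "r = measure ?L (G (t + M)) / measure ?L (G t)"
  have "ln (1 / (2 * real M / \<gamma>)) * (measure ?L (G t) - measure ?L (G (t + M)))
      - ?I * (\<Sum>j\<in>{t..<t+M}. measure ?L (G j)) \<le> ln 2 * measure ?L (G t)"
    unfolding G_def by (rule information_delay_bound[OF T])
      (use M \<open>0 < \<gamma>\<close> t in \<open>auto simp: G_def\<close>)
  then have "(?b * (measure ?L (G t) - measure ?L (G (t + M)))
      - ?I * (\<Sum>j\<in>{t..<t+M}. measure ?L (G j))) / measure ?L (G t) \<le> ln 2"
    using pos by (simp add: pos_divide_le_eq)
  then have key: "?b * (1 - r) - ?I * S \<le> ln 2"
    using pos by (simp add: S_def r_def diff_divide_distrib right_diff_distrib)
  \<comment> \<open>Markov's inequality in tail-sum form: each of the \<open>M\<close> survival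
    probabilities is at least the final one.\<close>
  have "(\<Sum>j\<in>{t..<t+M}. measure ?L (G (t + M))) \<le> (\<Sum>j\<in>{t..<t+M}. measure ?L (G j))"
    by (intro sum_mono L.finite_measure_mono mono GL) auto
  then have "real M * r \<le> S"
    using pos by (simp add: S_def r_def divide_right_mono)
  then have "r \<le> S / real M"
    using M by (simp add: field_simps)
  then have "?b * r \<le> ?b * (S / real M)"
    using b by (rule mult_left_mono)
  with key have "?b - ln 2 \<le> S * (?I + ?b / real M)"
    by (simp add: algebra_simps)
  moreover have "0 < ?I + ?b / real M"
    using I b by (simp add: add_pos_nonneg)
  ultimately have "(?b - ln 2) / (?I + ?b / real M) \<le> S"
    by (simp add: pos_divide_le_eq)
  then have "ennreal ((?b - ln 2) / (?I + ?b / real M)) \<le> ennreal S"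
    by (rule ennreal_leI)
  also have "\<dots> \<le> cond_delay P (Suc t) Q T"
    using cond_delay_ge[OF T, of t M] pos by (simp add: S_def G_def)
  also have "\<dots> \<le> CADD \<P> Q T"
  proof -
    have "not_yet_stopped P (Suc t) Q T = G t"
      by (auto simp: not_yet_stopped_def G_def space_change_law Suc_ile_eq)
    then show ?thesis
      unfolding CADD_def using \<open>P \<in> \<P>\<close> pos
      by (intro SUP_upper2[of "(P, Suc t)"]) (auto simp: L.emeasure_eq_measure)
  qed
  finally show ?thesis .
qed

end

section \<open>The log density as log-likelihood ratio\<close>

text \<open>Finite divergence supplies absolute continuity and integrability. The product of
  \<open>dQ/dP\<close> and \<open>exp (- l)\<close> is 1 where the density is positive and 0 where
  it vanishes, so it is at most 1 almost everywhere.\<close>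

lemma change_pair_llr_entropy_density:
  assumes "change_pair A P Q" and fin: "KL_div Q P < \<infinity>"
  shows "change_pair_llr A P Q (entropy_density (exp 1) P Q)"
proof -
  interpret change_pair A P Q by fact
  let ?l = "entropy_density (exp 1) P Q"
  have ac: "absolutely_continuous P Q" and int: "integrable Q ?l"
    using fin by (auto simp: KL_div_def split: if_splits)
  have sQP: "sets Q = sets P" by (simp add: sets_P sets_Q)
  have PA: "f \<in> borel_measurable P \<longleftrightarrow> f \<in> borel_measurable A" for f :: "'a \<Rightarrow> 'b :: topological_space"
    using measurable_cong_sets[OF sets_P refl] by blast
  show ?thesis
  proof
    show "?l \<in> borel_measurable A"
      unfolding PA[symmetric] by (rule measurable_entropy_density)
    show "integrable Q ?l" by (rule int)
    fix h :: "'a \<Rightarrow> ennreal" assume "h \<in> borel_measurable A"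
    then have h[measurable]: "h \<in> borel_measurable P" by (simp add: PA)
    have "AE x in P. RN_deriv P Q x \<noteq> \<infinity>"
      using P.RN_deriv_finite[OF Q.sigma_finite_measure ac sQP] .
    then have "AE x in P. RN_deriv P Q x * (h x * ennreal (exp (- ?l x))) \<le> h x"
    proof (rule AE_mp, intro AE_I2 impI)
      fix x assume "RN_deriv P Q x \<noteq> \<infinity>"
      then obtain r where r: "RN_deriv P Q x = ennreal r" "0 \<le> r"
        by (cases "RN_deriv P Q x") auto
      show "RN_deriv P Q x * (h x * ennreal (exp (- ?l x))) \<le> h x"
      proof (cases "r = 0")
        case False
        then have "ennreal r * ennreal (exp (- ?l x)) = 1"
          using r by (simp add: entropy_density_def log_def exp_minus flip: ennreal_mult)
        then show ?thesis using r by (metis mult.commute mult.left_commute mult_1 order_refl)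
      qed (use r in simp)
    qed
    then show "(\<integral>\<^sup>+x. h x * ennreal (exp (- ?l x)) \<partial>Q) \<le> (\<integral>\<^sup>+x. h x \<partial>P)"
      by (subst P.RN_deriv_nn_integral[OF ac sQP]) (auto intro: nn_integral_mono_AE)
  qed
qed

subsection \<open>Asymptotics\<close>

lemma (in change_pair_llr) Liminf_CADD_ge:
  assumes T: "\<And>\<gamma>. \<gamma> > 0 \<Longrightarrow> obs_stopping_time A (T \<gamma>)" and "P \<in> \<P>"
    and arl: "\<And>\<gamma>. \<gamma> > 0 \<Longrightarrow> ennreal \<gamma> \<le> (\<integral>\<^sup>+\<omega>. ennreal_of_enat (T \<gamma> \<omega>) \<partial>no_change_law P)"
    and I: "0 < (\<integral>x. l x \<partial>Q)"
  shows "ereal (1 / (\<integral>x. l x \<partial>Q))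
    \<le> Liminf at_top (\<lambda>\<gamma>::real. enn2ereal (CADD \<P> Q (T \<gamma>)) / ereal (ln \<gamma>))"
proof -
  define I where "I = (\<integral>x. l x \<partial>Q)"
  \<comment> \<open>The ceiling in \<open>M\<close> is removed: \<open>M\<close> is bounded above by
    \<open>(ln \<gamma>)\<^sup>2 + 1\<close> in the numerator, and \<open>b / M\<close> by
    \<open>1 / ln \<gamma>\<close> in the denominator.\<close>
  define f where "f \<gamma> = (ln (\<gamma> / (2 * ((ln \<gamma>)\<^sup>2 + 1))) - ln 2) / (I + 1 / ln \<gamma>) / ln \<gamma>" for \<gamma> :: real
  have "0 < I" using I by (simp add: I_def)
  have "((\<lambda>\<gamma>. f \<gamma>) \<longlongrightarrow> 1 / I) at_top"
    using \<open>0 < I\<close> unfolding f_def by (real_asymp simp: inverse_eq_divide)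
  then have lim: "((\<lambda>\<gamma>. ereal (f \<gamma>)) \<longlongrightarrow> ereal (1 / I)) at_top"
    by simp
  have "\<forall>\<^sub>F \<gamma> in at_top. ereal (f \<gamma>) \<le> enn2ereal (CADD \<P> Q (T \<gamma>)) / ereal (ln \<gamma>)"
  proof -
    have "\<forall>\<^sub>F \<gamma>::real in at_top. 1 \<le> ln \<gamma>" by real_asymp
    \<comment> \<open>This ensures both \<open>2M \<le> \<gamma>\<close> and
      \<open>ln 2 \<le> b'\<close>; the latter keeps the numerator nonnegative when the fractions
      are compared.\<close>
    moreover have "\<forall>\<^sub>F \<gamma>::real in at_top. 4 * ((ln \<gamma>)\<^sup>2 + 1) \<le> \<gamma>" by real_asymp
    ultimately show ?thesis
    proof eventually_elim
      case (elim \<gamma>)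
      \<comment> \<open>This \<open>M\<close> is large enough for \<open>b / M\<close> to vanish and
        small enough for \<open>ln M\<close> to be negligible against
        \<open>ln \<gamma>\<close>.\<close>
      define M where "M = nat \<lceil>(ln \<gamma>)\<^sup>2\<rceil>"
      define b where "b = ln (\<gamma> / (2 * real M))"
      define b' where "b' = ln (\<gamma> / (2 * ((ln \<gamma>)\<^sup>2 + 1)))"
      have sq: "1 \<le> (ln \<gamma>)\<^sup>2" using elim(1) by (simp add: one_le_power)
      have M: "(ln \<gamma>)\<^sup>2 \<le> real M" "real M \<le> (ln \<gamma>)\<^sup>2 + 1"
        unfolding M_def using sq by linarith+
      have M1: "1 \<le> M" using M sq by linarith
      have "4 * (ln \<gamma>)\<^sup>2 + 4 \<le> \<gamma>" using elim(2) by (simp add: distrib_left)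
      then have \<gamma>: "0 < \<gamma>" "2 * real M \<le> \<gamma>" using M sq by linarith+
      have "b \<le> ln \<gamma>"
        unfolding b_def using \<gamma> M1 by (subst ln_le_cancel_iff) (auto simp: field_simps)
      have "b' \<le> b"
        unfolding b_def b'_def using \<gamma> M M1 sq
        by (subst ln_le_cancel_iff) (auto intro!: divide_left_mono mult_pos_pos divide_pos_pos add_pos_pos)
      have "ln 2 \<le> b'"
        unfolding b'_def using elim(2) \<gamma> sq
        by (subst ln_le_cancel_iff) (auto simp: field_simps intro!: divide_pos_pos)
      have "0 \<le> b" using \<gamma> M1 by (simp add: b_def)
      have "b / real M \<le> ln \<gamma> / (ln \<gamma>)\<^sup>2"
        using \<open>0 \<le> b\<close> \<open>b \<le> ln \<gamma>\<close> M sq by (intro frac_le) auto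
      then have bM: "b / real M \<le> 1 / ln \<gamma>"
        using elim(1) by (simp add: power2_eq_square)
      have "f \<gamma> = (b' - ln 2) / (I + 1 / ln \<gamma>) / ln \<gamma>"
        by (simp add: f_def b'_def)
      also have "\<dots> \<le> (b - ln 2) / (I + b / real M) / ln \<gamma>"
        using \<open>b' \<le> b\<close> \<open>ln 2 \<le> b'\<close> bM \<open>0 < I\<close> \<open>0 \<le> b\<close> elim(1)
        by (intro divide_right_mono frac_le) (auto simp: add_pos_nonneg)
      finally have "ereal (f \<gamma>) \<le> ereal ((b - ln 2) / (I + b / real M)) / ereal (ln \<gamma>)"
        using elim(1) by simp
      also have "\<dots> \<le> enn2ereal (CADD \<P> Q (T \<gamma>)) / ereal (ln \<gamma>)"
      proof (rule ereal_divide_right_mono)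
        have "ennreal ((b - ln 2) / (I + b / real M)) \<le> CADD \<P> Q (T \<gamma>)"
          unfolding b_def I_def using T[of \<gamma>] arl[of \<gamma>] \<gamma> M1 I \<open>P \<in> \<P>\<close>
          by (intro CADD_lower_bound) auto
        then have "enn2ereal (ennreal ((b - ln 2) / (I + b / real M))) \<le> enn2ereal (CADD \<P> Q (T \<gamma>))"
          by (simp add: less_eq_ennreal.rep_eq)
        \<comment> \<open>The embedding \<open>ennreal\<close> sends negative reals to 0, so this
          comparison holds for either sign.\<close>
        moreover have "ereal x \<le> enn2ereal (ennreal x)" for x
          by (cases "0 \<le> x") (auto simp: enn2ereal_ennreal ennreal_neg zero_ennreal.rep_eq)
        ultimately show "ereal ((b - ln 2) / (I + b / real M)) \<le> enn2ereal (CADD \<P> Q (T \<gamma>))"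
          by (rule order_trans[rotated])
        show "0 < ereal (ln \<gamma>)" using elim(1) by simp
      qed
      finally show ?case .
    qed
  qed
  then have "Liminf at_top (\<lambda>\<gamma>. ereal (f \<gamma>))
      \<le> Liminf at_top (\<lambda>\<gamma>. enn2ereal (CADD \<P> Q (T \<gamma>)) / ereal (ln \<gamma>))"
    by (rule Liminf_mono)
  then show ?thesis
    using lim_imp_Liminf[OF _ lim] by (simp add: I_def)
qed

text \<open>The infimum defining \<open>KL_inf\<close> may not be attained. For each
  \<open>x\<close> above it some \<open>P\<close> has divergence below \<open>x\<close>, which
  yields the bound \<open>1 / x\<close>; then \<open>x\<close> decreases to the infimum.\<close>

theorem theorem1:
  fixes A :: "'a measure"
    and \<P> \<Q> :: "'a measure set"
    and T :: "real \<Rightarrow> (nat \<Rightarrow> 'a) \<Rightarrow> enat"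
    and Q :: "'a measure"
  assumes "\<P> \<noteq> {}" and "\<Q> \<noteq> {}"
    and "\<And>P. P \<in> \<P> \<Longrightarrow> prob_space P \<and> sets P = sets A"
    and "\<And>Q. Q \<in> \<Q> \<Longrightarrow> prob_space Q \<and> sets Q = sets A"
    and "\<And>\<gamma>. \<gamma> > 0 \<Longrightarrow> obs_stopping_time A (T \<gamma>)"
    and "\<And>\<gamma>. \<gamma> > 0 \<Longrightarrow>
           (INF P\<in>\<P>. \<integral>\<^sup>+\<omega>. ennreal_of_enat (T \<gamma> \<omega>) \<partial>no_change_law P) \<ge> ennreal \<gamma>"
    and "Q \<in> \<Q>"
    and "0 < KL_inf Q \<P>" and "KL_inf Q \<P> < \<infinity>"
  shows "Liminf at_top (\<lambda>\<gamma>::real. enn2ereal (CADD \<P> Q (T \<gamma>)) / ereal (ln \<gamma>))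
           \<ge> 1 / KL_inf Q \<P>"
proof -
  let ?C = "Liminf at_top (\<lambda>\<gamma>::real. enn2ereal (CADD \<P> Q (T \<gamma>)) / ereal (ln \<gamma>))"
  obtain J where J: "KL_inf Q \<P> = ereal J" "0 < J"
    using assms(8,9) by (cases "KL_inf Q \<P>") auto
  have near: "ereal (1 / x) \<le> ?C" if "J < x" for x
  proof -
    have "(INF P\<in>\<P>. KL_div Q P) < ereal x"
      using J that by (simp add: KL_inf_def)
    then obtain P where P: "P \<in> \<P>" "KL_div Q P < ereal x"
      by (auto simp: INF_less_iff)
    have fin: "KL_div Q P < \<infinity>"
      using P(2) by (rule order.strict_trans) simp
    have "change_pair A P Q"
      using assms(3)[OF P(1)] assms(4)[OF assms(7)]
      by (simp add: change_pair_def change_pair_axioms_def)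
    then interpret change_pair_llr A P Q "entropy_density (exp 1) P Q"
      using fin by (rule change_pair_llr_entropy_density)
    let ?I = "\<integral>x. entropy_density (exp 1) P Q x \<partial>Q"
    have KL: "KL_div Q P = ereal ?I"
      using fin by (auto simp: KL_div_def KL_divergence_def split: if_splits)
    \<comment> \<open>Positivity of the infimum passes to the chosen \<open>P\<close>, so that
      dividing by its divergence makes sense.\<close>
    have "ereal J \<le> KL_div Q P"
      unfolding J(1)[symmetric] KL_inf_def by (rule INF_lower) (rule P(1))
    then have I: "0 < ?I" "?I < x"
      using KL J(2) P(2) by auto
    have "ereal (1 / x) \<le> ereal (1 / ?I)"
      using I by (simp add: frac_le)
    also have "\<dots> \<le> ?C"
    proof (rule Liminf_CADD_ge[OF assms(5) P(1) _ I(1)])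
      fix \<gamma> :: real assume "0 < \<gamma>"
      from assms(6)[OF this]
      show "ennreal \<gamma> \<le> (\<integral>\<^sup>+\<omega>. ennreal_of_enat (T \<gamma> \<omega>) \<partial>no_change_law P)"
        by (rule order_trans) (rule INF_lower[OF P(1)])
    qed
    finally show ?thesis .
  qed
  have "((\<lambda>x. ereal (1 / x)) \<longlongrightarrow> ereal (1 / J)) (at_right J)"
    using J(2) by (auto intro!: tendsto_intros)
  moreover have "\<forall>\<^sub>F x in at_right J. ereal (1 / x) \<le> ?C"
    using near by (auto simp: eventually_at_filter)
  ultimately have "ereal (1 / J) \<le> ?C"
    by (rule tendsto_upperbound) simp
  then show ?thesis
    using J by (simp add: one_ereal_def)
qed

end
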